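(* Let $0<p<1$, $\alpha>0$, and let $\Phi:\mathbb{N}^{2}\to[1,\infty)$ satisfy $$\Phi(m_1,n_1)\ge \Phi(m_2,n_2)\quad\text{whenever } m_1\ge m_2 \text{ and } n_1\ge n_2,$$ and $$\lim_{m,n\to\infty}\Phi(m,n)=+\infty .$$ Then there exists a martingale $f\in H_p(G^2)$ such that $$\sup_{n,m\in\mathbb{N}_+}\ \sum_{\substack{2^{-\alpha}\le k/l\le 2^{\alpha}\\ (k,l)\le (n,m)}}\frac{\|S_{k,l}f\|_p^p\,\Phi(k,l)}{(kl)^{2-p}}=\infty,$$ where the sum runs over pairs of positive integers $(k,l)$ with $2^{-\alpha}\le k/l\le 2^{\alpha}$, and $(k,l)\le(n,m)$ means $k\le n$ and $l\le m$.
   Context: $\mathbb{N}_+$ is the set of positive integers and $\mathbb{N}=\mathbb{N}_+\cup\{0\}$. **Walsh group.** $Z_2=\{0,1\}$ is the discrete cyclic group of order 2, with Haar measure giving each singleton measure $1/2$. $G$ is the complete direct product of countably many copies of $Z_2$, with elements $x=(x_0,x_1,\dots)$, $x_k\in\{0,1\}$, coordinatewise addition modulo 2, product topology and product measure $\mu$. Write $G^2=G\times G$, with the product measure, also denoted $\mu$. For $x\in G$ and $n\in\mathbb{N}$ the dyadic intervals are $I_0(x)=G$ and $I_n(x)=\{y\in G: y_i=x_i \text{ for } 0\le i<n\}$. **Walsh–Paley system.** The Rademacher functions are $r_k(x)=(-1)^{x_k}$. For $n=\sum_{i\ge0}n_i2^i$ with $n_i\in\{0,1\}$, the Walsh–Paley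 function is $w_n(x)=\prod_{k=0}^{\infty}r_k(x)^{n_k}$. **Martingales and Hardy spaces.** $\mathcal{F}_n$ is the $\sigma$-algebra on $G^2$ generated by the dyadic squares $I_n(x)\times I_n(y)$, $(x,y)\in G^2$. A martingale $f=(f_n,\ n\in\mathbb{N})$ is a one-parameter martingale with respect to $(\mathcal{F}_n)_{n\in\mathbb{N}}$ (and $\mu$). Its maximal function is $f^*=\sup_{n\in\mathbb{N}}|f_n|$. For $0<p<\infty$, $\|g\|_p=\left(\int_{G^2}|g|^p\,d\mu\right)^{1/p}$, and the dyadic martingale Hardy space $H_p(G^2)$ consists of all martingales $f$ with $\|f\|_{H_p(G^2)}:=\|f^*\|_p<\infty$. **Fourier coefficients and partial sums.** The Walsh–Fourier coefficients of a martingale $f=(f_n)$ are $$\widehat f(i,j)=\lim_{k\to\infty}\int_{G^2}f_k(x,y)w_i(x)w_j(y)\,d\mu(x,y),\qquad i,j\in\mathbb{N},$$ and the rectangular partial sums are $$S_{M,N}f(x,y)=\sum_{i=0}^{M-1}\sum_{j=0}^{N-1}\widehat f(i,j)w_i(x)w_j(y).$$ *)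

theory Defs
  imports "HOL-Probability.Probability" "HOL-Library.Z2"
begin

type_synonym walsh_group = "nat \<Rightarrow> bit"

definition haar_Z2 :: "bit measure" where
  "haar_Z2 = uniform_count_measure UNIV"

definition haar_G :: "walsh_group measure" where
  "haar_G = PiM UNIV (\<lambda>_. haar_Z2)"

definition haar_G2 :: "(walsh_group \<times> walsh_group) measure" where
  "haar_G2 = haar_G \<Otimes>\<^sub>M haar_G"

definition dyadic_interval :: "nat \<Rightarrow> walsh_group \<Rightarrow> walsh_group set" where
  "dyadic_interval n x = {y. \<forall>i<n. y i = x i}"

definition rademacher :: "nat \<Rightarrow> walsh_group \<Rightarrow> real" where
  "rademacher k x = (if x k = 0 then 1 else -1)"

definition walsh :: "nat \<Rightarrow> walsh_group \<Rightarrow> real" where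
  "walsh n x = (\<Prod>k. rademacher k x ^ ((n div 2 ^ k) mod 2))"

definition dyadic_filtration :: "nat \<Rightarrow> (walsh_group \<times> walsh_group) measure" where
  "dyadic_filtration n =
     sigma UNIV {dyadic_interval n x \<times> dyadic_interval n y | x y. True}"

definition dyadic_martingale :: "(nat \<Rightarrow> walsh_group \<times> walsh_group \<Rightarrow> real) \<Rightarrow> bool" where
  "dyadic_martingale f \<longleftrightarrow>
     (\<forall>n. f n \<in> borel_measurable (dyadic_filtration n)) \<and>
     (\<forall>n. integrable haar_G2 (f n)) \<and>
     (\<forall>m n. m \<le> n \<longrightarrow>
        (AE z in haar_G2. real_cond_exp haar_G2 (dyadic_filtration m) (f n) z = f m z))"

definition maximal_function ::
    "(nat \<Rightarrow> walsh_group \<times> walsh_group \<Rightarrow> real) \<Rightarrow> walsh_group \<times> walsh_group \<Rightarrow> ennreal" where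
  "maximal_function f z = (SUP n. ennreal \<bar>f n z\<bar>)"

text \<open>Only used with a positive exponent.\<close>
definition ennpow :: "ennreal \<Rightarrow> real \<Rightarrow> ennreal" where
  "ennpow a p = (if a = \<infinity> then \<infinity> else ennreal (enn2real a powr p))"

text \<open>The argument stands for \<open>|g|\<close>, so that the maximal function, which may take the
  value \<open>\<infinity>\<close>, is covered as well.\<close>
definition Lp_norm :: "real \<Rightarrow> (walsh_group \<times> walsh_group \<Rightarrow> ennreal) \<Rightarrow> ennreal" where
  "Lp_norm p g = ennpow (\<integral>\<^sup>+ z. ennpow (g z) p \<partial>haar_G2) (1 / p)"

definition Hp_norm :: "real \<Rightarrow> (nat \<Rightarrow> walsh_group \<times> walsh_group \<Rightarrow> real) \<Rightarrow> ennreal" where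
  "Hp_norm p f = Lp_norm p (maximal_function f)"

definition hardy_space :: "real \<Rightarrow> (nat \<Rightarrow> walsh_group \<times> walsh_group \<Rightarrow> real) set" where
  "hardy_space p = {f. dyadic_martingale f \<and> Hp_norm p f < \<infinity>}"

definition walsh_coeff :: "(nat \<Rightarrow> walsh_group \<times> walsh_group \<Rightarrow> real) \<Rightarrow> nat \<Rightarrow> nat \<Rightarrow> real" where
  "walsh_coeff f i j =
     lim (\<lambda>k. \<integral>z. f k z * walsh i (fst z) * walsh j (snd z) \<partial>haar_G2)"

definition partial_sum ::
    "nat \<Rightarrow> nat \<Rightarrow> (nat \<Rightarrow> walsh_group \<times> walsh_group \<Rightarrow> real)
      \<Rightarrow> walsh_group \<times> walsh_group \<Rightarrow> real" where
  "partial_sum M N f z =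
     (\<Sum>i<M. \<Sum>j<N. walsh_coeff f i j * walsh i (fst z) * walsh j (snd z))"

lemma UNIV_bit: "(UNIV :: bit set) = {0, 1}"
  using bit_not_zero_iff by blast

lemma finite_UNIV_bit: "finite (UNIV :: bit set)"
  by (simp add: UNIV_bit)

lemma emeasure_haar_Z2: "emeasure haar_Z2 {a} = ennreal (1 / 2)"
proof -
  have "card (UNIV :: bit set) = 2"
    by (simp add: UNIV_bit)
  then show ?thesis
    unfolding haar_Z2_def
    by (subst emeasure_uniform_count_measure) (simp_all add: finite_UNIV_bit)
qed

lemma prob_space_haar_Z2: "prob_space haar_Z2"
  unfolding haar_Z2_def by (rule prob_space_uniform_count_measure) (auto simp: finite_UNIV_bit)

lemma prob_space_haar_G: "prob_space haar_G"
  unfolding haar_G_def by (intro prob_space_PiM prob_space_haar_Z2)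

lemma prob_space_haar_G2: "prob_space haar_G2"
proof -
  interpret prob_space haar_G by (rule prob_space_haar_G)
  interpret pair_prob_space haar_G haar_G ..
  show ?thesis unfolding haar_G2_def by (rule prob_space_axioms)
qed

lemma space_haar_G: "space haar_G = UNIV"
  by (simp add: haar_G_def haar_Z2_def space_PiM space_uniform_count_measure)

lemma space_haar_G2: "space haar_G2 = UNIV"
  by (simp add: haar_G2_def space_pair_measure space_haar_G)

lemma dyadic_interval_measurable: "dyadic_interval n x \<in> sets haar_G"
proof -
  have "{y \<in> space haar_G. \<forall>i\<in>{..<n}. y i = x i} \<in> sets haar_G"
  proof (rule sets.sets_Collect_finite_All)
    fix i
    have "(\<lambda>y. y i) \<in> measurable haar_G haar_Z2"
      unfolding haar_G_def by (rule measurable_component_singleton) simp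
    moreover have "{x i} \<in> sets haar_Z2"
      by (simp add: haar_Z2_def sets_uniform_count_measure)
    ultimately have "(\<lambda>y. y i) -` {x i} \<inter> space haar_G \<in> sets haar_G"
      by (rule measurable_sets)
    moreover have "(\<lambda>y. y i) -` {x i} \<inter> space haar_G = {y \<in> space haar_G. y i = x i}"
      by auto
    ultimately show "{y \<in> space haar_G. y i = x i} \<in> sets haar_G"
      by simp
  qed simp
  then show ?thesis
    by (simp add: space_haar_G dyadic_interval_def Ball_def)
qed

lemma subalgebra_dyadic_filtration: "subalgebra haar_G2 (dyadic_filtration n)"
proof -
  have "{dyadic_interval n x \<times> dyadic_interval n y | x y. True} \<subseteq> sets haar_G2"
    unfolding haar_G2_def by (auto intro!: pair_measureI dyadic_interval_measurable)
  then show ?thesis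
    unfolding subalgebra_def dyadic_filtration_def
    using sets.sigma_sets_subset[of _ haar_G2]
    by (simp add: space_haar_G2 sets_measure_of)
qed

lemma walsh_eq_prod: "walsh n x = (\<Prod>k<n. rademacher k x ^ ((n div 2 ^ k) mod 2))"
  unfolding walsh_def
proof (rule prodinf_finite)
  fix k assume "k \<notin> {..<n}"
  then have "n < 2 ^ k"
    using less_exp[of k] by (meson le_less_trans lessThan_iff not_less)
  then show "rademacher k x ^ ((n div 2 ^ k) mod 2) = 1"
    by simp
qed simp

end

theory Submission
  imports Defs
begin

text \<open>
  Put \<open>B\<^sub>s = \<Sum>\<^bsub>2^s \<le> i < 2^(s+1)\<^esub> w\<^sub>i\<close>, so that \<open>\<bar>B\<^sub>s\<bar> = 2^s\<close> on \<open>I\<^sub>s(0)\<close> and \<open>0\<close> elsewhere, and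
  \<open>f = \<Sum>\<^sub>s c\<^sub>s B\<^sub>s(x) B\<^sub>s(y)\<close>. By subadditivity of \<open>t \<mapsto> t^p\<close>, \<open>f\<close> lies in \<open>H\<^sub>p\<close> as soon as
  \<open>\<bar>c\<^sub>s\<bar>^p = \<lambda>\<^sub>s 4^(s(1-p))\<close> with \<open>\<lambda>\<close> summable.
  If \<open>x\<^sub>0 = 1\<close> then \<open>w\<^sub>2\<^sub>i(x) + w\<^sub>2\<^sub>i\<^sub>+\<^sub>1(x) = 0\<close>. Hence for odd \<open>k, l\<close> between \<open>2^s\<close> and \<open>2^(s+1)\<close> all complete
  blocks cancel on the quarter \<open>x\<^sub>0 = y\<^sub>0 = 1\<close> of \<open>G\<^sup>2\<close> and a single Walsh function survives from each
  factor of the last one: \<open>\<bar>S\<^sub>k\<^sub>,\<^sub>l f\<bar> = \<bar>c\<^sub>s\<bar>\<close> there. A fixed proportion of the \<open>4^s\<close> pairs satisfies the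
  restriction on \<open>k / l\<close>, so block \<open>s\<close> contributes at least a constant times
  \<open>\<lambda>\<^sub>s \<Phi>(2^s, 2^s)\<close>, and a sparse summable \<open>\<lambda>\<close> makes this unbounded.
\<close>

section \<open>Walsh functions and coordinate flips\<close>

text \<open>The cutoff \<open>K\<close> is free, so that Walsh functions of different indices can be
  expanded over one common range and compared factor by factor.\<close>

lemma walsh_bits:
  assumes "n < 2 ^ K"
  shows "walsh n x = (\<Prod>k<K. if bit n k then rademacher k x else 1)"
proof -
  have "walsh n x = (\<Prod>k<K. rademacher k x ^ ((n div 2 ^ k) mod 2))"
    unfolding walsh_def
  proof (rule prodinf_finite)
    fix k assume "k \<notin> {..<K}"
    then have "n < 2 ^ k"
      using assms power_increasing[of K k "2::nat"] by (simp add: not_less less_le_trans)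
    then show "rademacher k x ^ ((n div 2 ^ k) mod 2) = 1"
      by simp
  qed simp
  also have "\<dots> = (\<Prod>k<K. if bit n k then rademacher k x else 1)"
    by (intro prod.cong refl) (simp add: bit_iff_odd mod2_eq_if)
  finally show ?thesis .
qed

lemma walsh_0: "walsh 0 x = 1"
  using walsh_bits[of 0 0] by simp

text \<open>As bit \<open>k\<close> of \<open>n\<close> is unset, adding \<open>2 ^ k\<close> causes
  no carry and only inserts the factor \<open>rademacher k\<close>.\<close>

lemma walsh_set_bit:
  assumes "\<not> bit n k"
  shows "walsh (n + 2 ^ k) x = rademacher k x * walsh n x"
proof -
  define K where "K = Suc (n + 2 ^ k)"
  have K: "n + 2 ^ k < 2 ^ K" "n < 2 ^ K"
    using less_exp[of K] unfolding K_def by linarith+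
  have "k < 2 ^ k" by (rule less_exp)
  then have "k < K" unfolding K_def by linarith
  have "set_bit k n = n + 2 ^ k"
    using assms by (simp add: set_bit_eq)
  then have bits: "bit (n + 2 ^ k) j \<longleftrightarrow> bit n j \<or> j = k" for j
    using bit_set_bit_iff[of k n j] by auto
  have "walsh (n + 2 ^ k) x = (\<Prod>j<K. (if j = k then rademacher k x else 1) *
      (if bit n j then rademacher j x else 1))"
    unfolding walsh_bits[OF K(1)] using assms by (intro prod.cong refl) (simp add: bits)
  also have "\<dots> = rademacher k x * walsh n x"
    using \<open>k < K\<close> by (simp add: prod.distrib prod.delta walsh_bits[OF K(2)])
  finally show ?thesis .
qed

lemma abs_walsh: "\<bar>walsh n x\<bar> = 1"
  unfolding walsh_bits[OF less_exp] abs_prod by (intro prod.neutral) (simp add: rademacher_def)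

lemma walsh_cong:
  assumes "n < 2 ^ K" "\<And>k. k < K \<Longrightarrow> x k = y k"
  shows "walsh n x = walsh n y"
  unfolding walsh_bits[OF assms(1)] using assms(2) by (intro prod.cong) (auto simp: rademacher_def)

lemma measurable_component_haar_G: "(\<lambda>x. x k) \<in> measurable haar_G (count_space UNIV)"
proof -
  have "(\<lambda>x. x k) \<in> measurable haar_G haar_Z2"
    unfolding haar_G_def by (rule measurable_component_singleton) simp
  moreover have "sets haar_Z2 = sets (count_space UNIV)"
    by (simp add: haar_Z2_def sets_uniform_count_measure)
  ultimately show ?thesis
    using measurable_cong_sets[of haar_G haar_G haar_Z2 "count_space UNIV"] by simp
qed

lemma rademacher_measurable: "rademacher k \<in> borel_measurable haar_G"
proof -
  have "(\<lambda>b. if b = 0 then 1 else -1 :: real) \<circ> (\<lambda>x. x k) \<in> borel_measurable haar_G"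
    using measurable_component_haar_G by (rule measurable_comp) simp
  then show ?thesis by (simp add: comp_def rademacher_def[abs_def])
qed

lemma walsh_measurable [measurable]: "walsh n \<in> borel_measurable haar_G"
  unfolding walsh_bits[OF less_exp, abs_def] using rademacher_measurable by measurable

section \<open>Invariance of Haar measure under coordinate flips, and orthonormality\<close>

definition flip :: "nat \<Rightarrow> walsh_group \<Rightarrow> walsh_group" where
  "flip k x = x(k := x k + 1)"

lemma flip_measurable [measurable]: "flip k \<in> measurable haar_G haar_G"
proof -
  have "(\<lambda>x. \<lambda>i\<in>UNIV. flip k x i) \<in> measurable haar_G haar_G"
    unfolding haar_G_def
  proof (rule measurable_restrict)
    fix i
    have "(\<lambda>b. if i = k then b + 1 else b) \<circ> (\<lambda>x. x i) \<in> measurable haar_G (haar_Z2)"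
      using measurable_component_haar_G
      by (rule measurable_comp) (simp add: haar_Z2_def space_uniform_count_measure)
    moreover have "(\<lambda>b. if i = k then b + 1 else b) \<circ> (\<lambda>x. x i) = (\<lambda>x. flip k x i)"
      by (auto simp: flip_def)
    ultimately show "(\<lambda>x. flip k x i) \<in> measurable (PiM UNIV (\<lambda>_. haar_Z2)) haar_Z2"
      by (simp add: haar_G_def)
  qed
  then show ?thesis by (simp add: restrict_UNIV)
qed

lemma prod_emb_haar_Z2:
  "prod_emb UNIV (\<lambda>_. haar_Z2) J (Pi\<^sub>E J A) = {x. \<forall>i\<in>J. x i \<in> A i}"
  by (auto simp: prod_emb_def haar_Z2_def space_uniform_count_measure restrict_PiE_iff)

text \<open>A measure on the product is determined by its values on cylinders. The flip replaces the
  \<open>k\<close>-th side of a cylinder by its preimage under \<open>b + 1\<close>, which has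
  equally many elements and hence the same uniform measure.\<close>

lemma distr_flip: "distr haar_G haar_G (flip k) = haar_G"
proof (unfold haar_G_def, rule measure_eqI_PiM_infinite, fold haar_G_def)
  interpret P: prob_space haar_G by (rule prob_space_haar_G)
  interpret prob_space "distr haar_G haar_G (flip k)"
    by (rule P.prob_space_distr) measurable
  show "finite_measure (distr haar_G haar_G (flip k))"
    by unfold_locales
  fix A :: "nat \<Rightarrow> bit set" and J :: "nat set"
  assume J: "finite J" "J \<subseteq> UNIV"
  define B where "B i = (if i = k then (\<lambda>b. b + 1) -` A i else A i)" for i
  let ?emb = "\<lambda>A. prod_emb UNIV (\<lambda>_. haar_Z2) J (Pi\<^sub>E J A)"
  have sets_Z2: "X \<in> sets haar_Z2" for X
    by (simp add: haar_Z2_def sets_uniform_count_measure)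
  have meas: "?emb A \<in> sets haar_G" for A
    unfolding haar_G_def using J sets_Z2 by (intro sets_PiM_I) auto
  have eq: "flip k -` ?emb A \<inter> space haar_G = ?emb B"
    by (auto simp: prod_emb_haar_Z2 flip_def B_def space_haar_G split: if_splits)
  have "card ((\<lambda>b. b + 1) -` A k) = card (A k)"
  proof (rule card_vimage_inj)
    show "inj (\<lambda>b::bit. b + 1)" by (auto simp: inj_def)
    have "a = (a + 1) + 1" for a :: bit by (cases a) auto
    then show "A k \<subseteq> range (\<lambda>b. b + 1)" by blast
  qed
  then have B: "emeasure haar_Z2 (B i) = emeasure haar_Z2 (A i)" for i
    by (simp add: B_def haar_Z2_def emeasure_uniform_count_measure finite_UNIV_bit)
  have "emeasure (distr haar_G haar_G (flip k)) (?emb A) = emeasure haar_G (?emb B)"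
    by (subst emeasure_distr) (auto simp: meas eq)
  also have "\<dots> = emeasure haar_G (?emb A)"
    unfolding haar_G_def using J sets_Z2 B
    by (simp add: emeasure_PiM_emb prob_space_haar_Z2)
  finally show "emeasure (distr haar_G haar_G (flip k)) (?emb A) = emeasure haar_G (?emb A)" .
qed (simp_all add: haar_G_def)

definition flip1 :: "nat \<Rightarrow> walsh_group \<times> walsh_group \<Rightarrow> walsh_group \<times> walsh_group" where
  "flip1 k z = (flip k (fst z), snd z)"

definition flip2 :: "nat \<Rightarrow> walsh_group \<times> walsh_group \<Rightarrow> walsh_group \<times> walsh_group" where
  "flip2 k z = (fst z, flip k (snd z))"

lemma flip1_measurable [measurable]: "flip1 k \<in> measurable haar_G2 haar_G2"
  and flip2_measurable [measurable]: "flip2 k \<in> measurable haar_G2 haar_G2"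
  unfolding haar_G2_def flip1_def flip2_def by measurable

lemma distr_flip1: "distr haar_G2 haar_G2 (flip1 k) = haar_G2"
  and distr_flip2: "distr haar_G2 haar_G2 (flip2 k) = haar_G2"
proof -
  interpret prob_space haar_G by (rule prob_space_haar_G)
  have id: "distr haar_G haar_G (\<lambda>x. x) = haar_G"
    by (rule distr_id)
  have idm: "(\<lambda>x. x) \<in> measurable haar_G haar_G"
    by simp
  have "haar_G \<Otimes>\<^sub>M haar_G = distr (haar_G \<Otimes>\<^sub>M haar_G) (haar_G \<Otimes>\<^sub>M haar_G) (\<lambda>(x, y). (flip k x, y))"
    using pair_measure_distr[OF flip_measurable[of k] idm, unfolded id distr_flip]
      sigma_finite_measure_axioms by blast
  then show "distr haar_G2 haar_G2 (flip1 k) = haar_G2"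
    unfolding haar_G2_def flip1_def[abs_def] case_prod_unfold by (rule sym)
  have "haar_G \<Otimes>\<^sub>M haar_G = distr (haar_G \<Otimes>\<^sub>M haar_G) (haar_G \<Otimes>\<^sub>M haar_G) (\<lambda>(x, y). (x, flip k y))"
    using pair_measure_distr[OF idm flip_measurable[of k], unfolded id distr_flip]
      sigma_finite_measure_axioms by blast
  then show "distr haar_G2 haar_G2 (flip2 k) = haar_G2"
    unfolding haar_G2_def flip2_def[abs_def] case_prod_unfold by (rule sym)
qed

text \<open>Change of variables makes the integral equal to its own negative. With \<open>T\<close>
  a coordinate flip, this yields both the orthogonality of Walsh functions and the martingale
  property.\<close>

lemma integral_eq_0_of_antisymmetric:
  fixes g :: "'a \<Rightarrow> real"
  assumes "distr M M T = M" "T \<in> measurable M M" "g \<in> borel_measurable M"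
    and "\<And>z. g (T z) = - g z"
  shows "(\<integral>z. g z \<partial>M) = 0"
proof -
  have "(\<integral>z. g z \<partial>M) = (\<integral>z. g (T z) \<partial>M)"
    using integral_distr[OF assms(2,3)] assms(1) by simp
  then show ?thesis using assms(4) by simp
qed

text \<open>The flip changes the sign of \<open>rademacher k\<close> and of no other Rademacher
  function; that factor occurs exactly when bit \<open>k\<close> is set.\<close>

lemma walsh_flip: "walsh n (flip k x) = (if bit n k then - walsh n x else walsh n x)"
proof -
  define K where "K = n + k + 1"
  have "n < 2 ^ K"
    using less_exp[of K] unfolding K_def by linarith
  have "k < K" by (simp add: K_def)
  have "walsh n (flip k x) =
      (\<Prod>j<K. (if j = k then if bit n k then -1 else 1 else 1) * (if bit n j then rademacher j x else 1))"
    unfolding walsh_bits[OF \<open>n < 2 ^ K\<close>]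
    by (intro prod.cong) (auto simp: rademacher_def flip_def)
  also have "\<dots> = (if bit n k then -1 else 1) * walsh n x"
    using \<open>k < K\<close> by (simp add: prod.distrib prod.delta walsh_bits[OF \<open>n < 2 ^ K\<close>])
  finally show ?thesis by simp
qed

lemma walsh_measurable_fst [measurable]: "(\<lambda>z. walsh n (fst z)) \<in> borel_measurable haar_G2"
  and walsh_measurable_snd [measurable]: "(\<lambda>z. walsh n (snd z)) \<in> borel_measurable haar_G2"
  unfolding haar_G2_def by measurable

lemma walsh_integrable:
  "integrable haar_G2 (\<lambda>z. walsh i (fst z) * walsh j (snd z) * walsh a (fst z) * walsh b (snd z))"
proof -
  interpret prob_space haar_G2 by (rule prob_space_haar_G2)
  show ?thesis
    by (rule integrable_const_bound[where B=1]) (auto simp: abs_mult abs_walsh)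
qed

text \<open>Distinct index pairs differ in a bit of the first or of the second index; flipping that
  coordinate in the matching variable negates the integrand. For equal pairs the integrand is the
  constant 1.\<close>

lemma walsh_orthonormal:
  "(\<integral>z. walsh i (fst z) * walsh j (snd z) * walsh a (fst z) * walsh b (snd z) \<partial>haar_G2)
    = of_bool (i = a \<and> j = b)" (is "integral\<^sup>L _ ?g = _")
proof -
  interpret prob_space haar_G2 by (rule prob_space_haar_G2)
  have sq: "walsh n x * walsh n x = 1" for n x
    using abs_walsh[of n x] by (metis abs_mult_self_eq mult_1)
  consider "i \<noteq> a" | "j \<noteq> b" | "i = a" "j = b" by blast
  then show ?thesis
  proof cases
    case 1
    then obtain k where "bit i k \<noteq> bit a k" by (auto simp: bit_eq_iff)
    then have "integral\<^sup>L haar_G2 ?g = 0"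
      by (intro integral_eq_0_of_antisymmetric[OF distr_flip1[of k]]) (auto simp: flip1_def walsh_flip)
    with 1 show ?thesis by simp
  next
    case 2
    then obtain k where "bit j k \<noteq> bit b k" by (auto simp: bit_eq_iff)
    then have "integral\<^sup>L haar_G2 ?g = 0"
      by (intro integral_eq_0_of_antisymmetric[OF distr_flip2[of k]]) (auto simp: flip2_def walsh_flip)
    with 2 show ?thesis by simp
  next
    case 3
    have "walsh i x * walsh j y * walsh i x * walsh j y = 1" for x y
    proof -
      have "walsh i x * walsh j y * walsh i x * walsh j y
          = (walsh i x * walsh i x) * (walsh j y * walsh j y)"
        by (simp only: mult_ac)
      then show ?thesis by (simp only: sq mult_1)
    qed
    with 3 show ?thesis by (simp add: prob_space)
  qed
qed

section \<open>Walsh blocks and dyadic Dirichlet kernels\<close>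

definition walsh_block :: "nat \<Rightarrow> walsh_group \<Rightarrow> real" where
  "walsh_block s x = (\<Sum>i\<in>{2 ^ s..<2 ^ Suc s}. walsh i x)"

text \<open>The block is the difference of the Dirichlet kernels of orders 2^(s+1) and 2^s. Its
  indices are exactly \<open>i + 2 ^ s\<close> with \<open>i < 2 ^ s\<close>, so setting bit
  \<open>s\<close> pulls out a common Rademacher factor.\<close>

lemma walsh_block_eq: "walsh_block s x = rademacher s x * (\<Sum>i<2 ^ s. walsh i x)"
proof -
  have "walsh_block s x = (\<Sum>i<2 ^ s. walsh (i + 2 ^ s) x)"
    unfolding walsh_block_def
    using sum.shift_bounds_nat_ivl[of "\<lambda>i. walsh i x" 0 "2 ^ s" "2 ^ s"]
    by (simp add: mult_2 atLeast0LessThan)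
  also have "\<dots> = rademacher s x * (\<Sum>i<2 ^ s. walsh i x)"
    unfolding sum_distrib_left
    by (intro sum.cong refl walsh_set_bit) (simp add: bit_iff_odd)
  finally show ?thesis .
qed

text \<open>Paley's formula. Passing from \<open>s\<close> to \<open>Suc s\<close> multiplies the
  kernel by \<open>1 + rademacher s x\<close>, which is 2 where \<open>x s = 0\<close> and 0
  elsewhere: the support halves as the height doubles.\<close>

lemma dirichlet_kernel_pow2:
  "(\<Sum>i<2 ^ s. walsh i x) = 2 ^ s * indicator (dyadic_interval s (\<lambda>_. 0)) x"
proof (induction s)
  case 0
  then show ?case by (simp add: walsh_0 dyadic_interval_def)
next
  case (Suc s)
  have "(\<Sum>i<2 ^ Suc s. walsh i x) = (\<Sum>i<2 ^ s. walsh i x) + walsh_block s x"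
  proof -
    have "(2::nat) ^ s \<le> 2 ^ Suc s" by simp
    then have "{..<(2::nat) ^ Suc s} = {..<2 ^ s} \<union> {2 ^ s..<2 ^ Suc s}" by auto
    then show ?thesis
      unfolding walsh_block_def by (metis (no_types) sum.union_disjoint finite_lessThan finite_atLeastLessThan ivl_disj_int_one(2))
  qed
  also have "\<dots> = (1 + rademacher s x) * (2 ^ s * indicator (dyadic_interval s (\<lambda>_. 0)) x)"
    unfolding walsh_block_eq Suc.IH by (simp only: distrib_right mult_1)
  also have "\<dots> = 2 ^ Suc s * indicator (dyadic_interval (Suc s) (\<lambda>_. 0)) x"
  proof -
    have "x \<in> dyadic_interval (Suc s) (\<lambda>_. 0) \<longleftrightarrow> x \<in> dyadic_interval s (\<lambda>_. 0) \<and> x s = 0"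
      by (auto simp: dyadic_interval_def less_Suc_eq)
    then show ?thesis by (simp add: indicator_def rademacher_def)
  qed
  finally show ?case .
qed

lemma abs_walsh_block: "\<bar>walsh_block s x\<bar> = 2 ^ s * indicator (dyadic_interval s (\<lambda>_. 0)) x"
  unfolding walsh_block_eq dirichlet_kernel_pow2 by (simp add: abs_mult rademacher_def)

lemma walsh_block_measurable [measurable]: "walsh_block s \<in> borel_measurable haar_G"
  unfolding walsh_block_def[abs_def] by measurable

text \<open>All indices of the block are below 2^(s+1), so only the coordinates 0 to
  \<open>s\<close> enter.\<close>

lemma walsh_block_cong:
  assumes "s < K" "\<And>k. k < K \<Longrightarrow> x k = y k"
  shows "walsh_block s x = walsh_block s y"
  unfolding walsh_block_def
proof (intro sum.cong refl walsh_cong[of _ K])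
  fix i :: nat assume "i \<in> {2 ^ s..<2 ^ Suc s}"
  moreover have "(2::nat) ^ Suc s \<le> 2 ^ K"
    using assms(1) by (intro power_increasing) auto
  ultimately show "i < 2 ^ K" by simp
qed (use assms in auto)

text \<open>Every index of the block has \<open>s\<close> as its top bit, so each summand changes
  sign.\<close>

lemma walsh_block_flip: "walsh_block s (flip s x) = - walsh_block s x"
proof -
  have "bit i s" if "2 ^ s \<le> i" "i < 2 ^ Suc s" for i :: nat
  proof -
    have "i div 2 ^ s = 1" using that
      by (intro div_nat_eqI) auto
    then show ?thesis by (simp add: bit_iff_odd)
  qed
  then show ?thesis
    by (auto simp: walsh_block_def walsh_flip sum_negf[symmetric] intro!: sum.cong)
qed

section \<open>Dyadic squares and the filtration they generate\<close>

lemma emeasure_dyadic_interval: "emeasure haar_G (dyadic_interval n x) = ennreal (1 / 2 ^ n)"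
proof -
  have eq: "dyadic_interval n x = prod_emb UNIV (\<lambda>_. haar_Z2) {..<n} (Pi\<^sub>E {..<n} (\<lambda>i. {x i}))"
    by (auto simp: prod_emb_haar_Z2 dyadic_interval_def)
  have "{x i} \<in> sets haar_Z2" for i
    by (simp add: haar_Z2_def sets_uniform_count_measure)
  then have "emeasure haar_G (dyadic_interval n x) = (\<Prod>i<n. emeasure haar_Z2 {x i})"
    unfolding haar_G_def eq by (intro emeasure_PiM_emb prob_space_haar_Z2) auto
  also have "\<dots> = ennreal (1 / 2 ^ n)"
    unfolding emeasure_haar_Z2 prod_constant card_lessThan by (subst ennreal_power) (auto simp: power_one_over)
  finally show ?thesis .
qed

lemma emeasure_dyadic_square:
  "emeasure haar_G2 (dyadic_interval n x \<times> dyadic_interval n y) = ennreal (1 / 4 ^ n)"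
proof -
  interpret prob_space haar_G by (rule prob_space_haar_G)
  have "emeasure haar_G2 (dyadic_interval n x \<times> dyadic_interval n y)
      = ennreal (1 / 2 ^ n) * ennreal (1 / 2 ^ n)"
    unfolding haar_G2_def emeasure_pair_measure_Times[OF dyadic_interval_measurable dyadic_interval_measurable]
      emeasure_dyadic_interval ..
  also have "\<dots> = ennreal (1 / 2 ^ n * (1 / 2 ^ n))"
    by (rule ennreal_mult[symmetric]) auto
  also have "1 / 2 ^ n * (1 / 2 ^ n) = (1 / 4 ^ n :: real)"
    by (simp flip: power_mult_distrib)
  finally show ?thesis .
qed

lemma dyadic_square_measurable [measurable]:
  "dyadic_interval n x \<times> dyadic_interval n y \<in> sets haar_G2"
  unfolding haar_G2_def by (intro pair_measureI dyadic_interval_measurable)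

text \<open>Each further coordinate splits an interval in two. Finiteness turns the unions of
  squares in the measurability criterion below into finite ones.\<close>

lemma finite_range_dyadic_interval: "finite (range (dyadic_interval n))"
proof (induction n)
  case 0
  have "range (dyadic_interval 0) = {UNIV}" by (auto simp: dyadic_interval_def)
  then show ?case by simp
next
  case (Suc n)
  have "dyadic_interval (Suc n) x = (\<lambda>(I, b). I \<inter> {y. y n = b}) (dyadic_interval n x, x n)" for x
    by (auto simp: dyadic_interval_def less_Suc_eq)
  then have "range (dyadic_interval (Suc n))
      \<subseteq> (\<lambda>(I, b). I \<inter> {y. y n = b}) ` (range (dyadic_interval n) \<times> UNIV)"
    by (intro image_subsetI) (simp only:, intro imageI, simp)
  then show ?case
    by (rule finite_subset) (intro finite_imageI finite_cartesian_product Suc finite_UNIV_bit)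
qed

lemma space_dyadic_filtration: "space (dyadic_filtration n) = UNIV"
  by (simp add: dyadic_filtration_def space_measure_of_conv)

text \<open>A map of the first \<open>n\<close> coordinates is constant on each dyadic square of
  level \<open>n\<close>, so every preimage is the union of the finitely many squares contained in
  it.\<close>

lemma dyadic_filtration_measurableI:
  assumes "range f \<subseteq> space N"
    and "\<And>z z'. (\<And>k. k < n \<Longrightarrow> fst z k = fst z' k \<and> snd z k = snd z' k) \<Longrightarrow> f z = f z'"
  shows "f \<in> measurable (dyadic_filtration n) N"
proof (rule measurableI)
  show "f z \<in> space N" for z using assms(1) by auto
  fix A assume "A \<in> sets N"
  define S where "S = (\<lambda>(I, J). I \<times> J) ` (range (dyadic_interval n) \<times> range (dyadic_interval n))"
  define T where "T = {R \<in> S. R \<subseteq> f -` A}"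
  have square: "dyadic_interval n x \<times> dyadic_interval n y \<in> S" for x y
    unfolding S_def by (rule image_eqI[of _ _ "(dyadic_interval n x, dyadic_interval n y)"]) simp_all
  have "finite S"
    unfolding S_def by (intro finite_imageI finite_cartesian_product finite_range_dyadic_interval)
  then have "finite T"
    unfolding T_def by simp
  have "S \<subseteq> sets (dyadic_filtration n)"
  proof
    fix R assume "R \<in> S"
    then obtain x y where "R = dyadic_interval n x \<times> dyadic_interval n y"
      unfolding S_def by auto
    then show "R \<in> sets (dyadic_filtration n)"
      unfolding dyadic_filtration_def by (subst sets_measure_of) blast+
  qed
  then have "T \<subseteq> sets (dyadic_filtration n)"
    unfolding T_def by blast
  with \<open>finite T\<close> have "\<Union>T \<in> sets (dyadic_filtration n)"
    by (rule sets.finite_Union)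
  moreover have "f -` A \<inter> space (dyadic_filtration n) = \<Union>T"
  proof
    show "f -` A \<inter> space (dyadic_filtration n) \<subseteq> \<Union>T"
    proof
      fix z assume z: "z \<in> f -` A \<inter> space (dyadic_filtration n)"
      have "dyadic_interval n (fst z) \<times> dyadic_interval n (snd z) \<subseteq> f -` A"
      proof
        fix w assume "w \<in> dyadic_interval n (fst z) \<times> dyadic_interval n (snd z)"
        then have "f w = f z"
          by (intro assms(2)) (simp add: dyadic_interval_def mem_Times_iff)
        then show "w \<in> f -` A" using z by simp
      qed
      then have "dyadic_interval n (fst z) \<times> dyadic_interval n (snd z) \<in> T"
        unfolding T_def using square by simp
      moreover have "z \<in> dyadic_interval n (fst z) \<times> dyadic_interval n (snd z)"
        by (simp add: dyadic_interval_def mem_Times_iff)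
      ultimately show "z \<in> \<Union>T" by (rule UnionI)
    qed
    show "\<Union>T \<subseteq> f -` A \<inter> space (dyadic_filtration n)"
      by (auto simp: T_def space_dyadic_filtration)
  qed
  ultimately show "f -` A \<inter> space (dyadic_filtration n) \<in> sets (dyadic_filtration n)"
    by simp
qed

text \<open>Points with the same first \<open>n\<close> coordinates lie in the same generating
  squares, and this survives complements and countable unions.\<close>

lemma dyadic_filtration_sets_invariant:
  assumes "A \<in> sets (dyadic_filtration n)"
    and "\<And>k. k < n \<Longrightarrow> fst z k = fst z' k \<and> snd z k = snd z' k"
  shows "z \<in> A \<longleftrightarrow> z' \<in> A"
proof -
  have "A \<in> sigma_sets UNIV {dyadic_interval n x \<times> dyadic_interval n y | x y. True}"
    using assms(1) by (simp add: dyadic_filtration_def sets_measure_of_conv)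
  then show ?thesis
  proof (induction A rule: sigma_sets.induct)
    case (Basic A)
    then obtain x y where A: "A = dyadic_interval n x \<times> dyadic_interval n y" by blast
    show ?case
      unfolding A by (simp add: dyadic_interval_def mem_Times_iff assms(2))
  qed auto
qed

section \<open>Martingales built from Walsh blocks\<close>

text \<open>Block \<open>s\<close> involves the coordinates 0 to \<open>s\<close>, so the strict
  bound \<open>s < n\<close> makes term \<open>n\<close> depend on coordinates below
  \<open>n\<close> only.\<close>

definition block_martingale :: "(nat \<Rightarrow> real) \<Rightarrow> nat \<Rightarrow> walsh_group \<times> walsh_group \<Rightarrow> real" where
  "block_martingale c n z = (\<Sum>s<n. c s * (walsh_block s (fst z) * walsh_block s (snd z)))"

lemma walsh_block_measurable_fst [measurable]:
    "(\<lambda>z. walsh_block n (fst z)) \<in> borel_measurable haar_G2"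
  and walsh_block_measurable_snd [measurable]:
    "(\<lambda>z. walsh_block n (snd z)) \<in> borel_measurable haar_G2"
  unfolding haar_G2_def by measurable

lemma abs_walsh_block_le: "\<bar>walsh_block s x\<bar> \<le> 2 ^ s"
  unfolding abs_walsh_block by (simp add: indicator_def)

lemma walsh_block_integrable: "integrable haar_G2 (\<lambda>z. walsh_block s (fst z) * walsh_block s (snd z))"
proof -
  interpret prob_space haar_G2 by (rule prob_space_haar_G2)
  show ?thesis
  proof (rule integrable_const_bound[where B = "2 ^ s * 2 ^ s"])
    show "AE z in haar_G2. norm (walsh_block s (fst z) * walsh_block s (snd z)) \<le> 2 ^ s * 2 ^ s"
      by (auto simp: abs_mult intro!: mult_mono abs_walsh_block_le)
  qed measurable
qed

lemma block_martingale_integrable: "integrable haar_G2 (block_martingale c n)"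
  unfolding block_martingale_def[abs_def]
  by (intro Bochner_Integration.integrable_sum integrable_mult_right walsh_block_integrable)

lemma block_martingale_adapted: "block_martingale c n \<in> borel_measurable (dyadic_filtration n)"
proof (rule dyadic_filtration_measurableI)
  fix z z' :: "walsh_group \<times> walsh_group"
  assume eq: "\<And>k. k < n \<Longrightarrow> fst z k = fst z' k \<and> snd z k = snd z' k"
  have "walsh_block s (fst z) = walsh_block s (fst z')" "walsh_block s (snd z) = walsh_block s (snd z')"
    if "s < n" for s
    using eq by (auto intro: walsh_block_cong[OF that])
  then show "block_martingale c n z = block_martingale c n z'"
    unfolding block_martingale_def by (intro sum.cong) auto
qed simp

text \<open>Flipping coordinate \<open>s\<close> preserves \<open>A\<close> and negates the block.\<close>
lemma set_integral_walsh_block_eq_0: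
  assumes "A \<in> sets (dyadic_filtration m)" "m \<le> s"
  shows "(\<integral>z. indicator A z * (c * (walsh_block s (fst z) * walsh_block s (snd z))) \<partial>haar_G2) = 0"
proof (rule integral_eq_0_of_antisymmetric[OF distr_flip1[of s] flip1_measurable])
  have [measurable]: "A \<in> sets haar_G2"
    using assms(1) subalgebra_dyadic_filtration[of m] by (auto simp: subalgebra_def)
  show "(\<lambda>z. indicator A z * (c * (walsh_block s (fst z) * walsh_block s (snd z))))
      \<in> borel_measurable haar_G2"
    by measurable
  fix z
  have "flip1 s z \<in> A \<longleftrightarrow> z \<in> A"
    using assms(2) by (intro dyadic_filtration_sets_invariant[OF assms(1)]) (auto simp: flip1_def flip_def)
  then show "indicator A (flip1 s z) * (c * (walsh_block s (fst (flip1 s z)) * walsh_block s (snd (flip1 s z))))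
      = - (indicator A z * (c * (walsh_block s (fst z) * walsh_block s (snd z))))"
    by (simp add: indicator_def flip1_def walsh_block_flip)
qed

text \<open>Over a set of level \<open>m\<close>, the integrals of terms \<open>n\<close> and
  \<open>m\<close> differ by the blocks \<open>m \<le> s < n\<close>, each of which integrates to
  zero. Equality of these integrals characterises the conditional expectation.\<close>

lemma dyadic_martingale_block_martingale: "dyadic_martingale (block_martingale c)"
  unfolding dyadic_martingale_def
proof (intro conjI allI impI)
  fix m n :: nat assume "m \<le> n"
  interpret prob_space haar_G2 by (rule prob_space_haar_G2)
  interpret finite_measure_subalgebra haar_G2 "dyadic_filtration m"
    by unfold_locales (rule subalgebra_dyadic_filtration)
  show "AE z in haar_G2. real_cond_exp haar_G2 (dyadic_filtration m) (block_martingale c n) z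
      = block_martingale c m z"
  proof (rule real_cond_exp_charact)
    fix A assume A: "A \<in> sets (dyadic_filtration m)"
    have [measurable]: "A \<in> sets haar_G2"
      using A subalgebra_dyadic_filtration[of m] by (auto simp: subalgebra_def)
    let ?d = "\<lambda>s z. c s * (walsh_block s (fst z) * walsh_block s (snd z))"
    have int: "integrable haar_G2 (\<lambda>z. indicator A z * ?d s z)" for s
      using integrable_mult_indicator[OF \<open>A \<in> sets haar_G2\<close> integrable_mult_right[OF walsh_block_integrable[of s], of "c s"]]
      by simp
    have set_int: "(LINT z:A|haar_G2. block_martingale c k z)
        = (\<Sum>s<k. \<integral>z. indicator A z * ?d s z \<partial>haar_G2)" for k
      unfolding set_lebesgue_integral_def block_martingale_def real_scaleR_def sum_distrib_left
      by (intro Bochner_Integration.integral_sum int)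
    show "(LINT z:A|haar_G2. block_martingale c n z) = (LINT z:A|haar_G2. block_martingale c m z)"
      unfolding set_int using \<open>m \<le> n\<close> set_integral_walsh_block_eq_0[OF A]
      by (intro sum.mono_neutral_right) auto
  qed (auto intro: block_martingale_integrable block_martingale_adapted)
qed (auto intro: block_martingale_integrable block_martingale_adapted)

section \<open>Subadditivity of powers and the Hardy norm\<close>

lemma ennpow_ennreal: "0 \<le> x \<Longrightarrow> ennpow (ennreal x) p = ennreal (x powr p)"
  by (simp add: ennpow_def)

lemma ennpow_mono:
  assumes "0 < p" "a \<le> b"
  shows "ennpow a p \<le> ennpow b p"
  using assms
  by (cases a; cases b)
     (auto simp: ennpow_def top_unique intro!: ennreal_leI powr_mono2)

text \<open>Serves to undo the outer root in \<open>Lp_norm\<close>, including at the value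
  infinity.\<close>

lemma ennpow_ennpow_inverse:
  assumes "p * q = 1"
  shows "ennpow (ennpow a q) p = a"
proof (cases a)
  case (real r)
  then show ?thesis
    using assms by (simp add: ennpow_ennreal powr_powr mult.commute)
next
  case top
  then show ?thesis by (simp add: ennpow_def)
qed

text \<open>Write (a+b)^p as a(a+b)^(p-1) + b(a+b)^(p-1). As p-1 is at most 0, replacing the base
  a+b by the smaller a or b can only enlarge the two terms.\<close>

lemma powr_add_le:
  fixes a b :: real
  assumes "0 \<le> a" "0 \<le> b" "p \<le> 1"
  shows "(a + b) powr p \<le> a powr p + b powr p"
proof (cases "a = 0 \<or> b = 0")
  case False
  then have pos: "0 < a" "0 < b" using assms by auto
  have *: "x * (a + b) powr (p - 1) \<le> x powr p" if "0 < x" "x \<le> a + b" for x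
  proof -
    have "x * (a + b) powr (p - 1) \<le> x * x powr (p - 1)"
      using that assms by (intro mult_left_mono powr_mono2') auto
    also have "\<dots> = x powr p"
      using that by (simp add: powr_mult_base)
    finally show ?thesis .
  qed
  have "(a + b) powr p = (a + b) * (a + b) powr (p - 1)"
    using pos by (simp add: powr_mult_base)
  also have "\<dots> \<le> a powr p + b powr p"
    using *[of a] *[of b] pos by (simp add: distrib_right)
  finally show ?thesis .
qed auto

lemma powr_sum_le:
  fixes g :: "'a \<Rightarrow> real"
  assumes "finite A" "\<And>i. i \<in> A \<Longrightarrow> 0 \<le> g i" "p \<le> 1"
  shows "(\<Sum>i\<in>A. g i) powr p \<le> (\<Sum>i\<in>A. g i powr p)"
  using assms
proof (induction A rule: finite_induct)
  case (insert x F)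
  have "(\<Sum>i\<in>insert x F. g i) powr p \<le> g x powr p + (\<Sum>i\<in>F. g i) powr p"
    using insert by (simp add: powr_add_le sum_nonneg)
  with insert show ?case by fastforce
qed simp

text \<open>Subadditivity bounds the \<open>p\<close>-th power of each term by the sum of the
  \<open>p\<close>-th powers of its blocks. Block \<open>s\<close> has absolute value
  \<open>\<bar>c s\<bar> * 4 ^ s\<close> on one dyadic square and vanishes off it; the resulting
  bound is uniform in \<open>n\<close>.\<close>

lemma ennpow_maximal_function_le:
  assumes "0 < p" "p \<le> 1"
  shows "ennpow (maximal_function (block_martingale c) z) p
    \<le> (\<Sum>s. ennreal ((\<bar>c s\<bar> * 4 ^ s) powr p) *
          indicator (dyadic_interval s (\<lambda>_. 0) \<times> dyadic_interval s (\<lambda>_. 0)) z)" (is "_ \<le> ?H")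
proof -
  let ?d = "\<lambda>s. \<bar>c s * (walsh_block s (fst z) * walsh_block s (snd z))\<bar>"
  have d: "ennreal (?d s powr p) = ennreal ((\<bar>c s\<bar> * 4 ^ s) powr p) *
          indicator (dyadic_interval s (\<lambda>_. 0) \<times> dyadic_interval s (\<lambda>_. 0)) z" for s
    using power_mult_distrib[of "2::real" 2 s]
    by (cases z) (simp add: abs_mult abs_walsh_block indicator_def)
  have "ennreal \<bar>block_martingale c n z\<bar> \<le> ennpow ?H (1 / p)" for n
  proof -
    have "ennpow (ennreal \<bar>block_martingale c n z\<bar>) p = ennreal (\<bar>block_martingale c n z\<bar> powr p)"
      by (simp add: ennpow_ennreal)
    also have "\<dots> \<le> ennreal ((\<Sum>s<n. ?d s) powr p)"
      unfolding block_martingale_def using assms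
      by (intro ennreal_leI powr_mono2 sum_abs) auto
    also have "\<dots> \<le> ennreal (\<Sum>s<n. ?d s powr p)"
      using assms by (intro ennreal_leI powr_sum_le) auto
    also have "\<dots> = (\<Sum>s<n. ennreal (?d s powr p))"
      by (simp add: sum_ennreal)
    also have "\<dots> \<le> ?H"
      unfolding d by (rule sum_le_suminf) auto
    \<comment> \<open>Taking the root first bounds the term itself, so the supremum can be formed
      before the \<open>p\<close>-th power is restored.\<close>
    finally have "ennpow (ennpow (ennreal \<bar>block_martingale c n z\<bar>) p) (1 / p) \<le> ennpow ?H (1 / p)"
      using assms by (intro ennpow_mono) auto
    then show ?thesis
      using assms by (simp add: ennpow_ennpow_inverse)
  qed
  then have "maximal_function (block_martingale c) z \<le> ennpow ?H (1 / p)"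
    unfolding maximal_function_def by (rule SUP_least)
  then have "ennpow (maximal_function (block_martingale c) z) p \<le> ennpow (ennpow ?H (1 / p)) p"
    using assms by (intro ennpow_mono)
  then show ?thesis
    using assms by (simp add: ennpow_ennpow_inverse)
qed

text \<open>Integrating the pointwise bound termwise, block \<open>s\<close> contributes
  \<open>(\<bar>c s\<bar> * 4 ^ s) powr p\<close> times the measure \<open>1 / 4 ^ s\<close> of its
  square, which is the \<open>s\<close>-th term of the given series.\<close>

lemma block_martingale_in_hardy_space:
  assumes "0 < p" "p \<le> 1" "summable (\<lambda>s. \<bar>c s\<bar> powr p * 4 powr (real s * (p - 1)))"
  shows "block_martingale c \<in> hardy_space p"
proof -
  let ?R = "\<lambda>s. dyadic_interval s (\<lambda>_. 0) \<times> dyadic_interval s (\<lambda>_. 0)"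
  have "(\<integral>\<^sup>+ z. ennpow (maximal_function (block_martingale c) z) p \<partial>haar_G2)
      \<le> (\<integral>\<^sup>+ z. (\<Sum>s. ennreal ((\<bar>c s\<bar> * 4 ^ s) powr p) * indicator (?R s) z) \<partial>haar_G2)"
    using assms by (intro nn_integral_mono ennpow_maximal_function_le)
  also have "\<dots> = (\<Sum>s. \<integral>\<^sup>+ z. ennreal ((\<bar>c s\<bar> * 4 ^ s) powr p) * indicator (?R s) z \<partial>haar_G2)"
    by (rule nn_integral_suminf) measurable
  also have "\<dots> = (\<Sum>s. ennreal (\<bar>c s\<bar> powr p * 4 powr (real s * (p - 1))))"
  proof (rule suminf_cong)
    fix s
    have "(\<integral>\<^sup>+ z. ennreal ((\<bar>c s\<bar> * 4 ^ s) powr p) * indicator (?R s) z \<partial>haar_G2)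
        = ennreal ((\<bar>c s\<bar> * 4 ^ s) powr p) * ennreal (1 / 4 ^ s)"
      by (subst nn_integral_cmult_indicator) (auto simp: emeasure_dyadic_square)
    also have "\<dots> = ennreal ((\<bar>c s\<bar> * 4 ^ s) powr p * (1 / 4 ^ s))"
      by (rule ennreal_mult[symmetric]) auto
    also have "(\<bar>c s\<bar> * 4 ^ s) powr p * (1 / 4 ^ s) = \<bar>c s\<bar> powr p * 4 powr (real s * (p - 1))"
    proof -
      have "(4::real) ^ s = 4 powr real s"
        by (simp add: powr_realpow)
      then show ?thesis
        by (simp add: powr_mult powr_powr right_diff_distrib powr_diff)
    qed
    finally show "(\<integral>\<^sup>+ z. ennreal ((\<bar>c s\<bar> * 4 ^ s) powr p) * indicator (?R s) z \<partial>haar_G2)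
      = ennreal (\<bar>c s\<bar> powr p * 4 powr (real s * (p - 1)))" .
  qed
  also have "\<dots> < \<infinity>"
    using assms(3) by (simp add: suminf_ennreal2)
  finally have "(\<integral>\<^sup>+ z. ennpow (maximal_function (block_martingale c) z) p \<partial>haar_G2) \<noteq> \<infinity>"
    by simp
  then have "Hp_norm p (block_martingale c) < \<infinity>"
    by (simp add: Hp_norm_def Lp_norm_def ennpow_def)
  then show ?thesis
    by (simp add: hardy_space_def dyadic_martingale_block_martingale)
qed

section \<open>Partial sums\<close>

text \<open>After expanding both block factors, orthonormality keeps \<open>c s\<close> exactly when
  both indices lie in block \<open>s\<close>.\<close>

lemma integral_block_martingale_walsh:
  "(\<integral>z. block_martingale c n z * walsh i (fst z) * walsh j (snd z) \<partial>haar_G2)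
    = (\<Sum>s<n. c s * of_bool (i \<in> {2 ^ s..<2 ^ Suc s}) * of_bool (j \<in> {2 ^ s..<2 ^ Suc s}))"
proof -
  let ?B = "\<lambda>s. {2 ^ s..<2 ^ Suc s} :: nat set"
  let ?w = "\<lambda>a b z. walsh a (fst z) * walsh b (snd z) * walsh i (fst z) * walsh j (snd z)"
  have "(\<integral>z. block_martingale c n z * walsh i (fst z) * walsh j (snd z) \<partial>haar_G2)
      = (\<integral>z. (\<Sum>s<n. \<Sum>a\<in>?B s. \<Sum>b\<in>?B s. c s * ?w a b z) \<partial>haar_G2)"
    unfolding block_martingale_def walsh_block_def sum_product
    unfolding sum_distrib_left sum_distrib_right by (simp only: mult.assoc)
  also have "\<dots> = (\<Sum>s<n. \<Sum>a\<in>?B s. \<Sum>b\<in>?B s. c s * (\<integral>z. ?w a b z \<partial>haar_G2))"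
    by (subst Bochner_Integration.integral_sum, intro Bochner_Integration.integrable_sum
          integrable_mult_right walsh_integrable,
        rule sum.cong[OF refl],
        subst Bochner_Integration.integral_sum, intro Bochner_Integration.integrable_sum
          integrable_mult_right walsh_integrable,
        rule sum.cong[OF refl],
        subst Bochner_Integration.integral_sum, intro integrable_mult_right walsh_integrable,
        rule sum.cong[OF refl], rule integral_mult_right_zero)
  also have "\<dots> = (\<Sum>s<n. c s * of_bool (i \<in> ?B s) * of_bool (j \<in> ?B s))"
  proof (rule sum.cong[OF refl])
    fix s
    have "(\<Sum>a\<in>?B s. \<Sum>b\<in>?B s. c s * (\<integral>z. ?w a b z \<partial>haar_G2))
        = (\<Sum>a\<in>?B s. \<Sum>b\<in>?B s. if b = j then if a = i then c s else 0 else 0)"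
      unfolding walsh_orthonormal by (intro sum.cong refl) auto
    also have "\<dots> = c s * of_bool (i \<in> ?B s) * of_bool (j \<in> ?B s)"
      by (simp only: sum.delta finite_atLeastLessThan)
        (cases "j \<in> ?B s"; cases "i \<in> ?B s"; simp del: atLeastLessThan_iff power_Suc)
    finally show "(\<Sum>a\<in>?B s. \<Sum>b\<in>?B s. c s * (\<integral>z. ?w a b z \<partial>haar_G2))
        = c s * of_bool (i \<in> ?B s) * of_bool (j \<in> ?B s)" .
  qed
  finally show ?thesis .
qed

text \<open>The blocks from \<open>K\<close> on contain only indices above \<open>i\<close>, so the
  sequence of integrals is constant from \<open>K\<close> on.\<close>

lemma walsh_coeff_block_martingale:
  assumes "i < 2 ^ K"
  shows "walsh_coeff (block_martingale c) i j
    = (\<Sum>s<K. c s * of_bool (i \<in> {2 ^ s..<2 ^ Suc s}) * of_bool (j \<in> {2 ^ s..<2 ^ Suc s}))"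
  unfolding walsh_coeff_def integral_block_martingale_walsh
proof (intro limI tendsto_eventually eventually_sequentiallyI[of K])
  fix n assume "K \<le> n"
  have *: "i \<notin> {2 ^ s..<2 ^ Suc s}" if "s \<ge> K" for s
  proof -
    have "i < 2 ^ s"
      using assms power_increasing[OF that, of "2::nat"] by linarith
    then show ?thesis by simp
  qed
  show "(\<Sum>s<n. c s * of_bool (i \<in> {2 ^ s..<2 ^ Suc s}) * of_bool (j \<in> {2 ^ s..<2 ^ Suc s}))
    = (\<Sum>s<K. c s * of_bool (i \<in> {2 ^ s..<2 ^ Suc s}) * of_bool (j \<in> {2 ^ s..<2 ^ Suc s}))"
  proof (rule sum.mono_neutral_right)
    show "\<forall>s\<in>{..<n} - {..<K}.
        c s * of_bool (i \<in> {2 ^ s..<2 ^ Suc s}) * of_bool (j \<in> {2 ^ s..<2 ^ Suc s}) = 0"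
    proof
      fix s assume "s \<in> {..<n} - {..<K}"
      then have "i \<notin> {2 ^ s..<2 ^ Suc s}" by (intro *) simp
      then show "c s * of_bool (i \<in> {2 ^ s..<2 ^ Suc s}) * of_bool (j \<in> {2 ^ s..<2 ^ Suc s}) = 0"
        by (simp only: of_bool_eq mult_zero_left mult_zero_right)
    qed
  qed (use \<open>K \<le> n\<close> in auto)
qed

text \<open>A coefficient vanishes unless both indices lie in one block, so bounding the first index
  by \<open>2 ^ K\<close> leaves only the blocks below \<open>K\<close>. The \<open>min\<close>
  covers complete, truncated and empty blocks alike.\<close>

lemma partial_sum_block_martingale:
  assumes "M \<le> 2 ^ K"
  shows "partial_sum M N (block_martingale c) z
    = (\<Sum>s<K. c s * (\<Sum>i\<in>{2 ^ s..<min M (2 ^ Suc s)}. walsh i (fst z))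
                  * (\<Sum>j\<in>{2 ^ s..<min N (2 ^ Suc s)}. walsh j (snd z)))"
proof -
  let ?B = "\<lambda>s. {2 ^ s..<2 ^ Suc s} :: nat set"
  have restrict: "(\<Sum>i\<in>{2 ^ s..<min L (2 ^ Suc s)}. walsh i x) = (\<Sum>i<L. of_bool (i \<in> ?B s) * walsh i x)"
    for s L x
  proof -
    have "{2 ^ s..<min L (2 ^ Suc s)} = {i \<in> {..<L}. i \<in> ?B s}" by auto
    then show ?thesis
      by (simp only: sum.inter_filter[OF finite_lessThan] of_bool_def) (intro sum.cong refl, simp)
  qed
  have "partial_sum M N (block_martingale c) z
      = (\<Sum>i<M. \<Sum>j<N. \<Sum>s<K. c s * (of_bool (i \<in> ?B s) * walsh i (fst z))
          * (of_bool (j \<in> ?B s) * walsh j (snd z)))"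
    unfolding partial_sum_def
  proof (intro sum.cong refl)
    fix i j assume "i \<in> {..<M}"
    then have "i < 2 ^ K" using assms by simp
    then show "walsh_coeff (block_martingale c) i j * walsh i (fst z) * walsh j (snd z)
      = (\<Sum>s<K. c s * (of_bool (i \<in> ?B s) * walsh i (fst z)) * (of_bool (j \<in> ?B s) * walsh j (snd z)))"
      unfolding walsh_coeff_block_martingale[OF \<open>i < 2 ^ K\<close>] sum_distrib_right
      by (intro sum.cong refl) (simp only: mult_ac)
  qed
  also have "\<dots> = (\<Sum>s<K. \<Sum>i<M. \<Sum>j<N. c s * (of_bool (i \<in> ?B s) * walsh i (fst z))
          * (of_bool (j \<in> ?B s) * walsh j (snd z)))"
    by (subst sum.swap[of _ "{..<K}"], subst (2) sum.swap, rule refl)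
  also have "\<dots> = (\<Sum>s<K. c s * (\<Sum>i\<in>{2 ^ s..<min M (2 ^ Suc s)}. walsh i (fst z))
                  * (\<Sum>j\<in>{2 ^ s..<min N (2 ^ Suc s)}. walsh j (snd z)))"
    unfolding restrict sum_distrib_left sum_distrib_right by (intro sum.cong refl sum.swap)
  finally show ?thesis .
qed

section \<open>Cancellation where the leading coordinate is 1\<close>

lemma walsh_odd:
  assumes "x 0 = 1"
  shows "walsh (2 * i + 1) x = - walsh (2 * i) x"
  using walsh_set_bit[of "2 * i" 0 x] assms by (simp add: rademacher_def bit_0)

text \<open>An interval with even endpoints splits into pairs 2i, 2i+1, and each pair
  cancels.\<close>

lemma sum_walsh_even_interval:
  assumes "x 0 = 1" "a \<le> b"
  shows "(\<Sum>i\<in>{2 * a..<2 * b}. walsh i x) = 0"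
  using assms(2)
proof (induction b rule: dec_induct)
  case (step b)
  then show ?case
    using walsh_odd[of x b, OF assms(1)] by simp
qed simp

text \<open>For \<open>s < r\<close> the block is complete, and its endpoints are even because
  \<open>1 \<le> s\<close>, so it vanishes. For \<open>s = r\<close> the truncation keeps an
  interval with even endpoints and the single last index \<open>2 ^ r + 2 * t\<close>.\<close>

lemma sum_walsh_block_truncated:
  assumes "x 0 = 1" "1 \<le> s" "s \<le> r" "2 * t < 2 ^ r"
  shows "(\<Sum>i\<in>{2 ^ s..<min (2 ^ r + 2 * t + 1) (2 ^ Suc s)}. walsh i x)
    = (if s = r then walsh (2 ^ r + 2 * t) x else 0)"
proof (cases "s = r")
  case True
  obtain r' where r: "r = Suc r'" using assms by (cases r) auto
  have "(\<Sum>i\<in>{2 ^ r..<2 ^ r + 2 * t}. walsh i x) = 0"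
    using sum_walsh_even_interval[of x, OF assms(1), of "2 ^ r'" "2 ^ r' + t"] by (simp add: r)
  moreover have "min (2 ^ r + 2 * t + 1) (2 ^ Suc s) = Suc (2 ^ r + 2 * t)"
    using assms True by simp
  ultimately show ?thesis
    using True by simp
next
  case False
  then have "(2::nat) ^ Suc s \<le> 2 ^ r"
    using assms by (intro power_increasing) auto
  then have "min (2 ^ r + 2 * t + 1) (2 ^ Suc s) = (2::nat) ^ Suc s" by simp
  moreover obtain s' where "s = Suc s'" using assms by (cases s) auto
  ultimately show ?thesis
    using False sum_walsh_even_interval[of x, OF assms(1), of "2 ^ s'" "2 ^ s"] by simp
qed

text \<open>The block \<open>s = 0\<close> is the single function \<open>w\<^sub>1\<close>, which does not cancel; hence \<open>c 0 = 0\<close>.\<close>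
lemma abs_partial_sum_block_martingale:
  assumes "fst z 0 = 1" "snd z 0 = 1" "c 0 = 0" "1 \<le> r" "2 * t < 2 ^ r" "2 * t' < 2 ^ r"
  shows "\<bar>partial_sum (2 ^ r + 2 * t + 1) (2 ^ r + 2 * t' + 1) (block_martingale c) z\<bar> = \<bar>c r\<bar>"
proof -
  have "2 ^ r + 2 * t + 1 \<le> (2::nat) ^ Suc r"
    using assms by simp
  note partial_sum_block_martingale[OF this, of "2 ^ r + 2 * t' + 1" c z]
  also have "(\<Sum>s<Suc r. c s * (\<Sum>i\<in>{2 ^ s..<min (2 ^ r + 2 * t + 1) (2 ^ Suc s)}. walsh i (fst z))
        * (\<Sum>j\<in>{2 ^ s..<min (2 ^ r + 2 * t' + 1) (2 ^ Suc s)}. walsh j (snd z)))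
      = (\<Sum>s<Suc r. if s = r then c r * walsh (2 ^ r + 2 * t) (fst z) * walsh (2 ^ r + 2 * t') (snd z) else 0)"
  proof (rule sum.cong[OF refl])
    fix s assume s: "s \<in> {..<Suc r}"
    show "c s * (\<Sum>i\<in>{2 ^ s..<min (2 ^ r + 2 * t + 1) (2 ^ Suc s)}. walsh i (fst z))
        * (\<Sum>j\<in>{2 ^ s..<min (2 ^ r + 2 * t' + 1) (2 ^ Suc s)}. walsh j (snd z))
      = (if s = r then c r * walsh (2 ^ r + 2 * t) (fst z) * walsh (2 ^ r + 2 * t') (snd z) else 0)"
    proof (cases "s = 0")
      case False
      then have "1 \<le> s" "s \<le> r" using s by auto
      then show ?thesis
        using assms by (simp only: sum_walsh_block_truncated if_True) simp
    qed (use assms in simp)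
  qed
  also have "\<dots> = c r * walsh (2 ^ r + 2 * t) (fst z) * walsh (2 ^ r + 2 * t') (snd z)"
    by simp
  finally show ?thesis
    by (simp add: abs_mult abs_walsh)
qed

lemma ennpow_Lp_norm:
  assumes "0 < p"
  shows "ennpow (Lp_norm p g) p = (\<integral>\<^sup>+ z. ennpow (g z) p \<partial>haar_G2)"
  unfolding Lp_norm_def using assms by (intro ennpow_ennpow_inverse) simp

text \<open>The integral is restricted to the square where both leading coordinates are 1. It has
  measure 1/4, and the partial sum has absolute value \<open>\<bar>c r\<bar>\<close> there.\<close>

lemma Lp_norm_partial_sum_block_martingale_ge:
  assumes "0 < p" "c 0 = 0" "1 \<le> r" "2 * t < 2 ^ r" "2 * t' < 2 ^ r"
  shows "ennreal (\<bar>c r\<bar> powr p / 4)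
    \<le> ennpow (Lp_norm p (\<lambda>z. ennreal \<bar>partial_sum (2 ^ r + 2 * t + 1) (2 ^ r + 2 * t' + 1)
                                        (block_martingale c) z\<bar>)) p"
proof -
  let ?S = "\<lambda>z. \<bar>partial_sum (2 ^ r + 2 * t + 1) (2 ^ r + 2 * t' + 1) (block_martingale c) z\<bar>"
  let ?Q = "dyadic_interval 1 (\<lambda>_. 1) \<times> dyadic_interval 1 (\<lambda>_. 1)"
  have "ennreal (\<bar>c r\<bar> powr p / 4) = ennreal (\<bar>c r\<bar> powr p) * ennreal (1 / 4 ^ 1)"
    by (subst ennreal_mult[symmetric]) auto
  also have "\<dots> = (\<integral>\<^sup>+ z. ennreal (\<bar>c r\<bar> powr p) * indicator ?Q z \<partial>haar_G2)"
    by (subst nn_integral_cmult_indicator) (simp_all only: emeasure_dyadic_square dyadic_square_measurable)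
  also have "\<dots> \<le> (\<integral>\<^sup>+ z. ennpow (ennreal (?S z)) p \<partial>haar_G2)"
  proof (rule nn_integral_mono)
    fix z
    show "ennreal (\<bar>c r\<bar> powr p) * indicator ?Q z \<le> ennpow (ennreal (?S z)) p"
    proof (cases "z \<in> ?Q")
      case True
      then have "fst z 0 = 1" "snd z 0 = 1"
        by (auto simp: dyadic_interval_def)
      then have "?S z = \<bar>c r\<bar>"
        using assms by (intro abs_partial_sum_block_martingale)
      then show ?thesis
        using True by (simp add: ennpow_ennreal)
    qed simp
  qed
  finally show ?thesis
    using assms by (simp add: ennpow_Lp_norm)
qed

section \<open>Sparse summable weights\<close>

lemma unbounded_product_with_summable:
  fixes u :: "nat \<Rightarrow> real"
  assumes "filterlim u at_top sequentially"
  obtains w where "\<And>i. 0 \<le> w i" "summable w" "\<And>C n. \<exists>i\<ge>n. C \<le> w i * u i"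
proof -
  have "\<exists>N. \<forall>i\<ge>N. 4 ^ k \<le> u i" for k
    using assms by (auto simp: filterlim_at_top eventually_sequentially)
  then obtain N where N: "\<And>k i. N k \<le> i \<Longrightarrow> 4 ^ k \<le> u i" by metis
  \<comment> \<open>Cumulative sums make \<open>g\<close> strictly increasing while keeping
    \<open>g k\<close> above \<open>N k\<close>, so that \<open>u (g k)\<close> is at least
    \<open>4 ^ k\<close>.\<close>
  define g where "g k = (\<Sum>j\<le>k. Suc (N j))" for k
  have g: "strict_mono g"
    by (rule strict_mono_Suc_iff[THEN iffD2]) (simp add: g_def)
  have Ng: "N k \<le> g k" for k
    using member_le_sum[of k "{..k}" "\<lambda>j. Suc (N j)"] by (simp add: g_def)
  \<comment> \<open>Weight 2^(-k) sits at \<open>g k\<close> and zero elsewhere: the total is a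
    geometric series, yet \<open>w * u\<close> is at least 2^k at \<open>g k\<close>.\<close>
  define w :: "nat \<Rightarrow> real" where "w i = (if i \<in> range g then (1 / 2) ^ inv g i else 0)" for i
  have wg: "w (g k) = (1 / 2) ^ k" for k
    using strict_mono_imp_inj_on[OF g] by (simp add: w_def inv_f_f)
  show thesis
  proof
    show "0 \<le> w i" for i by (simp add: w_def)
    have "summable (\<lambda>k. w (g k))"
      unfolding wg by (rule summable_geometric) simp
    then show "summable w"
      by (subst (asm) summable_mono_reindex[OF g]) (auto simp: w_def)
    show "\<exists>i\<ge>n. C \<le> w i * u i" for C n
    proof -
      obtain k0 where k0: "C < 2 ^ k0" using real_arch_pow[of 2 C] by auto
      define k where "k = max n k0"
      have "(2::real) ^ k0 \<le> 2 ^ k"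
        by (intro power_increasing) (auto simp: k_def)
      then have "C \<le> 2 ^ k"
        using k0 by linarith
      also have "\<dots> = (1 / 2) ^ k * 4 ^ k"
        by (simp flip: power_mult_distrib)
      also have "\<dots> \<le> w (g k) * u (g k)"
        unfolding wg using N[OF Ng] by (intro mult_left_mono) auto
      finally have "C \<le> w (g k) * u (g k)" .
      moreover have "n \<le> g k"
        using strict_mono_imp_increasing[OF g, of k] by (simp add: k_def)
      ultimately show ?thesis by blast
    qed
  qed
qed

section \<open>Choice of the coefficients and divergence along the diagonal\<close>

theorem theorem1:
  fixes p \<alpha> :: real and \<Phi> :: "nat \<Rightarrow> nat \<Rightarrow> real"
  assumes "0 < p" and "p < 1" and "\<alpha> > 0"
    and "\<And>m n. \<Phi> m n \<ge> 1"
    and "\<And>m1 n1 m2 n2. m1 \<ge> m2 \<Longrightarrow> n1 \<ge> n2 \<Longrightarrow> \<Phi> m1 n1 \<ge> \<Phi> m2 n2"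
    and "filterlim (\<lambda>(m, n). \<Phi> m n) at_top (sequentially \<times>\<^sub>F sequentially)"
  shows "\<exists>f \<in> hardy_space p.
    (SUP (n, m) \<in> {1..} \<times> {1..}.
       \<Sum>(k, l) \<in> {(k, l). 1 \<le> k \<and> 1 \<le> l \<and> k \<le> n \<and> l \<le> m \<and>
                      2 powr (- \<alpha>) \<le> real k / real l \<and> real k / real l \<le> 2 powr \<alpha>}.
         ennpow (Lp_norm p (\<lambda>z. ennreal \<bar>partial_sum k l f z\<bar>)) p * ennreal (\<Phi> k l)
           / ennreal ((real k * real l) powr (2 - p))) = \<infinity>"
proof -
  define u where "u s = \<Phi> (2 ^ s) (2 ^ s)" for s :: nat
  \<comment> \<open>The limit of \<open>\<Phi>\<close> is taken along the diagonal of powers of two;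
    monotonicity will carry these values to all larger arguments.\<close>
  have "filterlim (\<lambda>s. (2 ^ s, 2 ^ s) :: nat \<times> nat) (sequentially \<times>\<^sub>F sequentially) sequentially"
    by (intro filterlim_Pair filterlim_subseq strict_monoI power_strict_increasing) auto
  from filterlim_compose[OF assms(6) this] have "filterlim u at_top sequentially"
    by (simp add: u_def[abs_def])
  then obtain w where w: "\<And>i. 0 \<le> w i" "summable w" "\<And>C n. \<exists>i\<ge>n. C \<le> w i * u i"
    by (rule unbounded_product_with_summable) blast
  \<comment> \<open>The root is chosen so that the \<open>s\<close>-th term of the series
    controlling the Hardy norm equals \<open>w s\<close> for positive \<open>s\<close>. The value 0
    at \<open>s = 0\<close> removes the one block that does not cancel.\<close>
  define c where "c s = (if s = 0 then 0 else (w s * 4 powr (real s * (1 - p))) powr (1 / p))" for s :: nat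
  have c: "\<bar>c s\<bar> powr p = w s * 4 powr (real s * (1 - p))" if "s \<noteq> 0" for s
    using that assms(1) w(1) by (simp add: c_def powr_powr)
  have "block_martingale c \<in> hardy_space p"
  proof (rule block_martingale_in_hardy_space)
    show "summable (\<lambda>s. \<bar>c s\<bar> powr p * 4 powr (real s * (p - 1)))"
    proof (rule summable_comparison_test'[OF w(2)])
      fix s :: nat assume "1 \<le> s"
      then have "\<bar>c s\<bar> powr p * 4 powr (real s * (p - 1))
          = w s * (4 powr (real s * (1 - p)) * 4 powr (real s * (p - 1)))"
        by (simp add: c)
      also have "\<dots> = w s"
        by (simp flip: powr_add add: algebra_simps)
      finally show "norm (\<bar>c s\<bar> powr p * 4 powr (real s * (p - 1))) \<le> w s"
        using w(1) by simp
    qed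
  qed (use assms in auto)
  moreover
  define summand where "summand k l = ennpow (Lp_norm p (\<lambda>z. ennreal \<bar>partial_sum k l (block_martingale c) z\<bar>)) p
      * ennreal (\<Phi> k l) / ennreal ((real k * real l) powr (2 - p))" for k l
  define Ind where "Ind n m = {(k, l). 1 \<le> k \<and> 1 \<le> l \<and> k \<le> n \<and> l \<le> m \<and>
      2 powr (- \<alpha>) \<le> real k / real l \<and> real k / real l \<le> 2 powr \<alpha>}" for n m :: nat
  \<comment> \<open>Numbers between 2^s and 2^s (1 + 2^(-q)) have ratios at most
    \<open>2 powr \<alpha>\<close>; \<open>q\<close> does not depend on \<open>s\<close>, so the
    proportion of usable pairs stays fixed.\<close>
  obtain q :: nat where q: "1 + (1 / 2) ^ q \<le> 2 powr \<alpha>"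
  proof -
    have "0 < 2 powr \<alpha> - 1" using assms(3) by simp
    then obtain q where "(1 / 2) ^ q < 2 powr \<alpha> - 1"
      using real_arch_pow_inv[of "2 powr \<alpha> - 1" "1 / 2"] by auto
    then show ?thesis by (intro that[of q]) simp
  qed
  \<comment> \<open>There are 4^(s-q-1) pairs, each contributing at least \<open>w s * u s\<close>
    times 4^(s(1-p)) / 4 / 4^((s+1)(2-p)). The multiples of \<open>s\<close> in the exponent cancel
    and leave p - q - 4.\<close>
  have lower: "ennreal (w s * u s * 4 powr (p - real q - 4)) \<le> (\<Sum>(k, l)\<in>Ind (2 ^ Suc s) (2 ^ Suc s). summand k l)"
    if "q + 1 \<le> s" for s
  proof -
    \<comment> \<open>odd numbers in \<open>(2^s, 2^s (1 + 2^-q))\<close>, whose pairwise ratios stay below \<open>2 powr \<alpha>\<close>\<close>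
    define T where "T = (\<lambda>t. 2 ^ s + 2 * t + 1 :: nat) ` {..<2 ^ (s - q - 1)}"
    have pow: "(2::nat) ^ (s - q) = 2 * 2 ^ (s - q - 1)"
      using that by (simp flip: power_Suc)
    have pow_le: "(2::nat) ^ (s - q) \<le> 2 ^ s"
      by (intro power_increasing) auto
    have T_gt: "2 ^ s < k" and T_le: "k \<le> 2 ^ s + 2 ^ (s - q)" if "k \<in> T" for k
      using that unfolding T_def pow by auto
    have T_pos: "0 < k" if "k \<in> T" for k
      using T_gt[OF that] by simp
    have T_le2: "k \<le> 2 ^ Suc s" if "k \<in> T" for k
      unfolding power_Suc using T_le[OF that] pow_le by linarith
    have ratio: "real k / real l \<le> 2 powr \<alpha>" if "k \<in> T" "l \<in> T" for k l
    proof -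
      have eq: "(2::real) ^ (s - q) = 2 ^ s * (1 / 2) ^ q"
        using \<open>q + 1 \<le> s\<close> by (simp add: power_diff power_one_over)
      have "real k \<le> 2 ^ s + 2 ^ (s - q)"
        using of_nat_mono[OF T_le[OF that(1)], where 'a = real] by simp
      also have "\<dots> = 2 ^ s * (1 + (1 / 2) ^ q)"
        unfolding eq by (simp add: distrib_left)
      also have "\<dots> \<le> real l * 2 powr \<alpha>"
      proof (intro mult_mono q)
        show "2 ^ s \<le> real l"
          using of_nat_mono[OF less_imp_le[OF T_gt[OF that(2)]], where 'a = real] by simp
      qed auto
      finally show ?thesis
        using T_pos[OF that(2)] by (simp add: divide_le_eq mult.commute)
    qed
    have sub: "T \<times> T \<subseteq> Ind (2 ^ Suc s) (2 ^ Suc s)"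
    proof clarify
      fix k l assume kl: "k \<in> T" "l \<in> T"
      then have pos: "0 < k" "0 < l" using T_pos by auto
      \<comment> \<open>The lower bound on k/l is the upper bound on l/k inverted, as both numbers
        come from the same set \<open>T\<close>.\<close>
      have "inverse (2 powr \<alpha>) \<le> inverse (real l / real k)"
        using ratio[OF kl(2,1)] pos by (intro le_imp_inverse_le) auto
      then have "2 powr (- \<alpha>) \<le> real k / real l"
        by (simp add: powr_minus)
      then show "(k, l) \<in> Ind (2 ^ Suc s) (2 ^ Suc s)"
        using ratio[OF kl] T_le2[OF kl(1)] T_le2[OF kl(2)] pos by (simp add: Ind_def del: power_Suc)
    qed
    have fin: "finite (Ind (2 ^ Suc s) (2 ^ Suc s))"
      by (rule finite_subset[of _ "{..2 ^ Suc s} \<times> {..2 ^ Suc s}"]) (auto simp: Ind_def)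
    have "inj_on (\<lambda>t. 2 ^ s + 2 * t + 1 :: nat) {..<2 ^ (s - q - 1)}"
      by (auto simp: inj_on_def)
    then have card: "card (T \<times> T) = 4 ^ (s - q - 1)"
      unfolding card_cartesian_product T_def by (simp add: card_image flip: power_mult_distrib)
    \<comment> \<open>A lower bound common to all pairs: the norm gives
      \<open>\<bar>c s\<bar> powr p / 4\<close>, monotonicity gives \<open>u s\<close> since k and l
      exceed 2^s, and kl is at most 4^(s+1).\<close>
    define b where "b = \<bar>c s\<bar> powr p / 4 * u s / 4 powr ((real s + 1) * (2 - p))"
    have u: "1 \<le> u s" unfolding u_def by (rule assms(4))
    have b: "0 \<le> b" unfolding b_def using u by simp
    have term_ge: "ennreal b \<le> summand k l" if kl: "k \<in> T" "l \<in> T" for k l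
    proof -
      have pos: "0 < real k * real l" using T_pos kl by simp
      have "real k \<le> 2 ^ Suc s" "real l \<le> 2 ^ Suc s"
        using of_nat_mono[OF T_le2[OF kl(1)], where 'a = real]
          of_nat_mono[OF T_le2[OF kl(2)], where 'a = real] by simp_all
      then have "real k * real l \<le> 2 ^ Suc s * 2 ^ Suc s"
        by (intro mult_mono) auto
      also have "\<dots> = 4 powr (real s + 1)"
        by (simp add: powr_add powr_realpow flip: power_mult_distrib)
      finally have "(real k * real l) powr (2 - p) \<le> (4 powr (real s + 1)) powr (2 - p)"
        using assms(2) pos by (intro powr_mono2) auto
      then have denom: "(real k * real l) powr (2 - p) \<le> 4 powr ((real s + 1) * (2 - p))"
        by (simp add: powr_powr)
      have Phi: "u s \<le> \<Phi> k l"
        unfolding u_def using T_gt kl by (intro assms(5) less_imp_le)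
      have norm: "ennreal (\<bar>c s\<bar> powr p / 4)
          \<le> ennpow (Lp_norm p (\<lambda>z. ennreal \<bar>partial_sum k l (block_martingale c) z\<bar>)) p"
      proof -
        have t: "2 * t < 2 ^ s" if "t < 2 ^ (s - q - 1)" for t :: nat
          using that pow pow_le by linarith
        obtain t t' where "k = 2 ^ s + 2 * t + 1" "t < 2 ^ (s - q - 1)"
            "l = 2 ^ s + 2 * t' + 1" "t' < 2 ^ (s - q - 1)"
          using kl unfolding T_def by auto
        then show ?thesis
          using assms(1) \<open>q + 1 \<le> s\<close> t
          by (simp only:) (rule Lp_norm_partial_sum_block_martingale_ge; simp add: c_def)
      qed
      have "b \<le> \<bar>c s\<bar> powr p / 4 * \<Phi> k l / (real k * real l) powr (2 - p)"
        unfolding b_def using denom Phi u T_pos[OF kl(1)] T_pos[OF kl(2)] by (intro frac_le mult_left_mono) auto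
      then have "ennreal b \<le> ennreal (\<bar>c s\<bar> powr p / 4 * \<Phi> k l / (real k * real l) powr (2 - p))"
        by (rule ennreal_leI)
      also have "\<dots> = ennreal (\<bar>c s\<bar> powr p / 4) * ennreal (\<Phi> k l) / ennreal ((real k * real l) powr (2 - p))"
        using T_pos[OF kl(1)] T_pos[OF kl(2)] Phi u by (simp add: divide_ennreal flip: ennreal_mult)
      also have "\<dots> \<le> summand k l"
        unfolding summand_def by (intro divide_right_mono_ennreal mult_right_mono norm) auto
      finally show ?thesis .
    qed
    have "w s * u s * 4 powr (p - real q - 4) = real (card (T \<times> T)) * b"
    proof -
      have "real (card (T \<times> T)) = 4 powr (real s - real q - 1)"
        using that by (simp add: card powr_realpow[symmetric] of_nat_diff diff_diff_add add.commute)
      moreover have "b = w s * u s * (4 powr (real s * (1 - p)) / 4 powr 1 / 4 powr ((real s + 1) * (2 - p)))"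
        unfolding b_def using that by (subst c) auto
      moreover have "4 powr (real s - real q - 1) * (4 powr (real s * (1 - p)) / 4 powr 1 / 4 powr ((real s + 1) * (2 - p)))
          = 4 powr (p - real q - 4)"
        unfolding powr_diff[symmetric] powr_add[symmetric] by (simp add: algebra_simps)
      ultimately show ?thesis by (simp only: mult_ac)
    qed
    then have "ennreal (w s * u s * 4 powr (p - real q - 4)) = (\<Sum>(k, l)\<in>T \<times> T. ennreal b)"
      using b by (simp add: ennreal_mult ennreal_of_nat_eq_real_of_nat split_def)
    also have "\<dots> \<le> (\<Sum>(k, l)\<in>T \<times> T. summand k l)"
      by (rule sum_mono) (use term_ge in auto)
    also have "\<dots> \<le> (\<Sum>(k, l)\<in>Ind (2 ^ Suc s) (2 ^ Suc s). summand k l)"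
      by (rule sum_mono2[OF fin sub]) auto
    finally show ?thesis .
  qed
  have "(SUP (n, m) \<in> {1..} \<times> {1..}. \<Sum>(k, l)\<in>Ind n m. summand k l) = \<infinity>" (is "?SUP = _")
  proof (rule ccontr)
    assume "?SUP \<noteq> \<infinity>"
    then obtain r where r: "0 \<le> r" "?SUP = ennreal r"
      by (cases ?SUP) auto
    \<comment> \<open>The products \<open>w s * u s\<close> are unbounded beyond every index, so
      some \<open>s\<close> past the threshold \<open>q + 1\<close> makes block \<open>s\<close>
      alone exceed the supposed finite supremum.\<close>
    obtain s where s: "q + 1 \<le> s" "(r + 1) / 4 powr (p - real q - 4) \<le> w s * u s"
      using w(3) by blast
    then have "r + 1 \<le> w s * u s * 4 powr (p - real q - 4)"
      by (simp add: pos_divide_le_eq)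
    then have "ennreal (r + 1) \<le> (\<Sum>(k, l)\<in>Ind (2 ^ Suc s) (2 ^ Suc s). summand k l)"
      using lower[OF s(1)] by (meson ennreal_leI order_trans)
    also have "\<dots> \<le> ?SUP"
      by (rule SUP_upper2[of "(2 ^ Suc s, 2 ^ Suc s)"]) auto
    finally show False
      using r by (simp add: ennreal_le_iff)
  qed
  ultimately show ?thesis
    unfolding summand_def Ind_def by (intro bexI[of _ "block_martingale c"])
qed

end
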